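(* Let $\Omega\subset\mathbb{R}^d$ be a periodic domain (a rectangular box with periodic boundary conditions), let $r>0$, $a>0$ and $\Delta t>0$, and let $(\phi^n)_{n\ge 0}$ be a sequence of real-valued $\Omega$-periodic functions, smooth enough that the following equations make sense pointwise and $\mu^{n+1}$ is twice continuously differentiable and periodic, satisfying for all $n\ge 0$ the convex splitting scheme $$\frac{\phi^{n+1}-\phi^n}{\Delta t}=\Delta\mu^{n+1},$$ $$\mu^{n+1}=(1-r+a)\phi^{n+1}+\Delta^2\phi^{n+1}+(\phi^n)^3-a\phi^n-2\Delta\phi^n .$$ Then the scheme conserves mass exactly, for every $\Delta t>0$: $$\int_\Omega \phi^{n+1}\,dx=\int_\Omega\phi^n\,dx\qquad\text{for all } n\ge 0.$$
   Context: The scheme is a first-order time discretization (continuous in space) of the phase field crystal equation $\phi_t=\Delta\mu$, $\mu=\phi^3+(1-r)\phi+2\Delta\phi+\Delta^2\phi$, where $\phi$ is the atomistic density field, $r>0$ is the undercooling parameter, $a>0$ is the splitting parameter and $\Delta t$ is the time step. $\Delta$ is the Laplacian on $\Omega$ and $\Delta^2$ the bilaplacian. *)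

theory Defs
  imports "HOL-Analysis.Analysis"
begin

text \<open>
  Partial derivatives are taken along the vectors of the standard orthonormal basis, so
  \<open>i\<close> is meant to range over \<open>Basis\<close>.  Where the derivative does not exist, \<open>deriv\<close> is
  unspecified, so \<open>partial\<close> and \<open>laplacian\<close> are meaningful only under differentiability hypotheses.
\<close>

definition partial :: "'a::euclidean_space \<Rightarrow> ('a \<Rightarrow> real) \<Rightarrow> 'a \<Rightarrow> real" where
  "partial i f x = deriv (\<lambda>t. f (x + t *\<^sub>R i)) 0"

definition laplacian :: "('a::euclidean_space \<Rightarrow> real) \<Rightarrow> 'a \<Rightarrow> real" where
  "laplacian f x = (\<Sum>i\<in>Basis. partial i (partial i f) x)"

definition twice_differentiable :: "('a::euclidean_space \<Rightarrow> real) \<Rightarrow> bool" where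
  "twice_differentiable f \<longleftrightarrow>
     f differentiable_on UNIV \<and> (\<forall>i\<in>Basis. partial i f differentiable_on UNIV)"

definition twice_continuously_differentiable :: "('a::euclidean_space \<Rightarrow> real) \<Rightarrow> bool" where
  "twice_continuously_differentiable f \<longleftrightarrow>
     twice_differentiable f \<and>
     (\<forall>i\<in>Basis. \<forall>j\<in>Basis. continuous_on UNIV (partial j (partial i f)))"

text \<open>
  Functions on the box with corners \<open>l\<close> and \<open>u\<close> under periodic boundary conditions are
  represented by their periodic extensions to the whole space.
\<close>

definition box_periodic :: "'a::euclidean_space \<Rightarrow> 'a \<Rightarrow> ('a \<Rightarrow> real) \<Rightarrow> bool" where
  "box_periodic l u f \<longleftrightarrow> (\<forall>i\<in>Basis. \<forall>x. f (x + ((u - l) \<bullet> i) *\<^sub>R i) = f x)"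

end

theory Submission imports Defs begin

text \<open>
  Mass changes only through the integral of the Laplacian of \<open>\<mu>\<close>, so everything rests on the
  divergence theorem on a torus: a continuous partial derivative of a differentiable periodic
  function \<open>g\<close> has integral zero over the period box.  This is a consequence of translation
  invariance.  The integral of a periodic function over the box does not change when the
  function is translated along an edge \<open>i\<close>, because the slab pushed out at one face is a translate,
  by one period, of the slab left uncovered at the other
  (\<open>integral_translate_periodic\<close>).  Hence \<open>s \<mapsto> \<integral> g (x + s i) dx\<close> is constant, and
  differentiating under the integral sign shows that the integral of \<open>partial i g\<close>
  vanishes (\<open>integral_partial_periodic\<close>).  The Laplacian of a periodic function is a sum of such
  derivatives, with \<open>g = partial i f\<close>, which inherits periodicity from \<open>f\<close>
  (\<open>has_integral_laplacian_periodic\<close>).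
\<close>

text \<open>
  The definition of \<open>partial\<close> only differentiates at parameter \<open>0\<close>; moving the base point along
  the line turns it into the derivative at any parameter, as needed under the integral sign.
\<close>

lemma has_real_derivative_partial:
  fixes f :: "'a::euclidean_space \<Rightarrow> real"
  assumes "f differentiable_on UNIV"
  shows "((\<lambda>s. f (x + s *\<^sub>R i)) has_real_derivative partial i f (x + s *\<^sub>R i)) (at s)"
proof -
  define g where "g = (\<lambda>t. f ((x + s *\<^sub>R i) + t *\<^sub>R i))"
  have "f differentiable (at y)" for y
    using assms by (simp add: differentiable_on_def)
  then have "g differentiable (at 0)"
    unfolding g_def by (rule differentiable_compose[of f]) (intro derivative_intros)
  then have "(g has_real_derivative deriv g 0) (at 0)"
    by (simp add: DERIV_deriv_iff_real_differentiable)
  moreover have "g = (\<lambda>t. f (x + (t + s) *\<^sub>R i))"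
    by (simp add: g_def algebra_simps)
  ultimately show ?thesis
    using DERIV_shift[of "\<lambda>t. f (x + t *\<^sub>R i)" "deriv g 0" 0 s]
    by (simp add: partial_def g_def)
qed

lemma box_periodic_partial:
  assumes "box_periodic l u f"
  shows "box_periodic l u (partial i f)"
  unfolding box_periodic_def partial_def
proof (intro ballI allI)
  fix k x assume "k \<in> (Basis :: 'a set)"
  then have "f (x + ((u - l) \<bullet> k) *\<^sub>R k + t *\<^sub>R i) = f (x + t *\<^sub>R i)" for t
    using assms unfolding box_periodic_def by (metis add.assoc add.commute)
  then show "deriv (\<lambda>t. f (x + ((u - l) \<bullet> k) *\<^sub>R k + t *\<^sub>R i)) 0 = deriv (\<lambda>t. f (x + t *\<^sub>R i)) 0"
    by simp
qed

lemma integral_cbox_split: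
  fixes f :: "'a::euclidean_space \<Rightarrow> real"
  assumes "continuous_on UNIV f" and "k \<in> Basis"
  shows "integral (cbox a b) f
    = integral (cbox a b \<inter> {x. x \<bullet> k \<le> c}) f + integral (cbox a b \<inter> {x. x \<bullet> k \<ge> c}) f"
proof -
  have "f integrable_on cbox a b"
    using assms(1) by (intro integrable_continuous) (rule continuous_on_subset, auto)
  then show ?thesis
    using assms(2) integrable_split[of f a b k c]
    by (intro integral_unique has_integral_split[of f _ a b k c]) (auto simp: has_integral_integral)
qed

lemma cbox_Int_halfspaces:
  fixes a b :: "'a::euclidean_space"
  assumes i: "i \<in> Basis"
  shows "c \<le> b \<bullet> i \<Longrightarrow> cbox a b \<inter> {x. x \<bullet> i \<le> c} = cbox a (b - (b \<bullet> i - c) *\<^sub>R i)"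
    and "a \<bullet> i \<le> c \<Longrightarrow> cbox a b \<inter> {x. x \<bullet> i \<ge> c} = cbox (a + (c - a \<bullet> i) *\<^sub>R i) b"
proof -
  have upper: "(b - (b \<bullet> i - c) *\<^sub>R i) \<bullet> k = (if k = i then c else b \<bullet> k)"
    and lower: "(a + (c - a \<bullet> i) *\<^sub>R i) \<bullet> k = (if k = i then c else a \<bullet> k)"
    if "k \<in> Basis" for k
    using that i by (auto simp: inner_Basis algebra_simps)
  show "cbox a b \<inter> {x. x \<bullet> i \<le> c} = cbox a (b - (b \<bullet> i - c) *\<^sub>R i)" if "c \<le> b \<bullet> i"
    unfolding set_eq_iff Int_iff mem_box mem_Collect_eq
    using that i upper by (smt (verit))
  show "cbox a b \<inter> {x. x \<bullet> i \<ge> c} = cbox (a + (c - a \<bullet> i) *\<^sub>R i) b" if "a \<bullet> i \<le> c"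
    unfolding set_eq_iff Int_iff mem_box mem_Collect_eq
    using that i lower by (smt (verit))
qed

text \<open>
  Both the box and its translate by \<open>s\<close> along \<open>i\<close> consist of their common part and one slab of
  thickness \<open>s\<close>, and the two slabs differ by exactly one period.
\<close>

lemma integral_translate_periodic:
  fixes f :: "'a::euclidean_space \<Rightarrow> real"
  assumes cont: "continuous_on UNIV f" and per: "box_periodic l u f" and i: "i \<in> Basis"
    and s: "0 \<le> s" "s \<le> (u - l) \<bullet> i"
  shows "integral (cbox l u) (\<lambda>x. f (x + s *\<^sub>R i)) = integral (cbox l u) f"
proof -
  define L where "L = (u - l) \<bullet> i"
  let ?m = "u - (L - s) *\<^sub>R i"
  have translate: "integral (cbox a b) (\<lambda>x. f (x + c)) = integral (cbox (a + c) (b + c)) f" for a b c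
    using integral_shift_cbox[of "a + c" c "b + c" f] by simp
  \<comment> \<open>The common part is \<open>cbox (l + s *\<^sub>R i) u\<close>; the slabs are \<open>cbox l ?m\<close> and its translate.\<close>
  have lower: "cbox l u \<inter> {x. x \<bullet> i \<le> l \<bullet> i + s} = cbox l ?m"
    using cbox_Int_halfspaces(1)[OF i, of "l \<bullet> i + s" u l] s
    by (simp add: L_def inner_diff_left inner_add_left algebra_simps)
  have upper: "cbox l u \<inter> {x. x \<bullet> i \<ge> l \<bullet> i + s} = cbox (l + s *\<^sub>R i) u"
    using cbox_Int_halfspaces(2)[OF i, of l "l \<bullet> i + s" u] s
    by (simp add: L_def inner_diff_left inner_add_left algebra_simps)
  have lower': "cbox (l + s *\<^sub>R i) (u + s *\<^sub>R i) \<inter> {x. x \<bullet> i \<le> u \<bullet> i} = cbox (l + s *\<^sub>R i) u"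
    using cbox_Int_halfspaces(1)[OF i, of "u \<bullet> i" "u + s *\<^sub>R i" "l + s *\<^sub>R i"] s i
    by (simp add: L_def inner_diff_left inner_add_left algebra_simps)
  have upper': "cbox (l + s *\<^sub>R i) (u + s *\<^sub>R i) \<inter> {x. x \<bullet> i \<ge> u \<bullet> i}
      = cbox (l + L *\<^sub>R i) (?m + L *\<^sub>R i)"
    using cbox_Int_halfspaces(2)[OF i, of "l + s *\<^sub>R i" "u \<bullet> i" "u + s *\<^sub>R i"] s i
    by (simp add: L_def inner_diff_left inner_add_left algebra_simps)
  have "integral (cbox l u) (\<lambda>x. f (x + s *\<^sub>R i))
      = integral (cbox (l + s *\<^sub>R i) u) f + integral (cbox (l + L *\<^sub>R i) (?m + L *\<^sub>R i)) f"
    using integral_cbox_split[OF cont i, of "l + s *\<^sub>R i" "u + s *\<^sub>R i" "u \<bullet> i"]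
    by (simp only: translate lower' upper')
  also have "integral (cbox (l + L *\<^sub>R i) (?m + L *\<^sub>R i)) f = integral (cbox l ?m) f"
    using per i by (simp only: translate[symmetric]) (simp add: box_periodic_def L_def)
  also have "integral (cbox (l + s *\<^sub>R i) u) f + integral (cbox l ?m) f = integral (cbox l u) f"
    using integral_cbox_split[OF cont i, of l u "l \<bullet> i + s"] by (simp add: lower upper)
  finally show ?thesis .
qed

text \<open>
  The integral of the translated function is constant in the translation length \<open>s\<close>, and its
  derivative at \<open>s = 0\<close> is the integral of the partial derivative.  The derivative is taken within
  one period \<open>[0, L]\<close>, that is one-sided, since this is the range of lengths for which
  \<open>integral_translate_periodic\<close> applies.
\<close>

lemma integral_partial_periodic:
  fixes g :: "'a::euclidean_space \<Rightarrow> real"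
  assumes diff: "g differentiable_on UNIV" and cont: "continuous_on UNIV (partial i g)"
    and per: "box_periodic l u g" and i: "i \<in> Basis" and pos: "l \<bullet> i < u \<bullet> i"
  shows "integral (cbox l u) (partial i g) = 0"
proof -
  let ?S = "{0..(u - l) \<bullet> i}"
  let ?J = "\<lambda>s. integral (cbox l u) (\<lambda>x. g (x + s *\<^sub>R i))"
  have contg: "continuous_on UNIV g"
    using diff by (rule differentiable_imp_continuous_on)
  have L: "0 < (u - l) \<bullet> i"
    using pos by (simp add: inner_diff_left)
  have "(?J has_real_derivative integral (cbox l u) (\<lambda>x. partial i g (x + 0 *\<^sub>R i))) (at 0 within ?S)"
  proof (rule leibniz_rule_field_derivative)
    show "((\<lambda>s. g (x + s *\<^sub>R i)) has_real_derivative partial i g (x + s *\<^sub>R i)) (at s within ?S)"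
      for s x
      using has_real_derivative_partial[OF diff] by (rule has_field_derivative_at_within)
    show "(\<lambda>x. g (x + s *\<^sub>R i)) integrable_on cbox l u" for s
      by (intro integrable_continuous continuous_on_compose2[OF contg] continuous_intros) auto
    show "continuous_on (?S \<times> cbox l u) (\<lambda>(s, x). partial i g (x + s *\<^sub>R i))"
      unfolding split_beta
      by (intro continuous_on_compose2[OF cont] continuous_intros) auto
  qed (use L in auto)
  then have "(?J has_vector_derivative integral (cbox l u) (partial i g)) (at 0 within ?S)"
    by (simp add: has_real_derivative_iff_has_vector_derivative)
  moreover have "(?J has_vector_derivative 0) (at 0 within ?S)"
  proof (rule has_vector_derivative_transform)
    show "?J s = integral (cbox l u) g" if "s \<in> ?S" for s
      using that integral_translate_periodic[OF contg per i] by simp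
  qed (use L in auto)
  moreover have "at 0 within ?S \<noteq> bot"
    using L by (simp add: trivial_limit_within islimpt_Icc)
  ultimately show ?thesis
    by (rule vector_derivative_unique_within[rotated])
qed

lemma has_integral_laplacian_periodic:
  fixes f :: "'a::euclidean_space \<Rightarrow> real"
  assumes smooth: "twice_continuously_differentiable f" and per: "box_periodic l u f"
    and box: "\<And>i. i \<in> Basis \<Longrightarrow> l \<bullet> i < u \<bullet> i"
  shows "(laplacian f has_integral 0) (cbox l u)"
proof -
  have "(partial i (partial i f) has_integral 0) (cbox l u)" if i: "i \<in> Basis" for i
  proof -
    have diff: "partial i f differentiable_on UNIV"
      and cont: "continuous_on UNIV (partial i (partial i f))"
      using smooth i
      by (auto simp: twice_continuously_differentiable_def twice_differentiable_def)
    have "partial i (partial i f) integrable_on cbox l u"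
      using cont by (intro integrable_continuous) (rule continuous_on_subset, auto)
    then show ?thesis
      using integral_partial_periodic[OF diff cont box_periodic_partial[OF per] i box[OF i]]
      by (simp add: has_integral_integral)
  qed
  then have "((\<lambda>x. \<Sum>i\<in>Basis. partial i (partial i f) x) has_integral (\<Sum>i\<in>(Basis::'a set). 0))
      (cbox l u)"
    by (intro has_integral_sum) auto
  then show ?thesis
    by (simp add: laplacian_def[abs_def])
qed

theorem theorem1:
  fixes l u :: "'a::euclidean_space"
    and r a dt :: real
    and \<phi> \<mu> :: "nat \<Rightarrow> 'a \<Rightarrow> real"
  assumes box: "\<And>i. i \<in> Basis \<Longrightarrow> l \<bullet> i < u \<bullet> i"
    and r: "r > 0" and a: "a > 0" and dt: "dt > 0"
    and phi_periodic: "\<And>n. box_periodic l u (\<phi> n)"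
    and phi_smooth: "\<And>n. twice_differentiable (\<phi> n)"
    and lap_phi_smooth: "\<And>n. twice_differentiable (laplacian (\<phi> (Suc n)))"
    and mu_periodic: "\<And>n. box_periodic l u (\<mu> (Suc n))"
    and mu_smooth: "\<And>n. twice_continuously_differentiable (\<mu> (Suc n))"
    and scheme_phi: "\<And>n x. (\<phi> (Suc n) x - \<phi> n x) / dt = laplacian (\<mu> (Suc n)) x"
    and scheme_mu: "\<And>n x. \<mu> (Suc n) x =
          (1 - r + a) * \<phi> (Suc n) x + laplacian (laplacian (\<phi> (Suc n))) x
          + (\<phi> n x) ^ 3 - a * \<phi> n x - 2 * laplacian (\<phi> n) x"
  shows "\<forall>n. integral (cbox l u) (\<phi> (Suc n)) = integral (cbox l u) (\<phi> n)"
proof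
  fix n
  have "continuous_on UNIV (\<phi> n)"
    using phi_smooth[of n]
    by (auto simp: twice_differentiable_def intro: differentiable_imp_continuous_on)
  then have "\<phi> n integrable_on cbox l u"
    by (intro integrable_continuous) (rule continuous_on_subset, auto)
  moreover have "((\<lambda>x. dt * laplacian (\<mu> (Suc n)) x) has_integral dt * 0) (cbox l u)"
    using has_integral_laplacian_periodic[OF mu_smooth mu_periodic box]
    by (rule has_integral_mult_right)
  ultimately have "((\<lambda>x. \<phi> n x + dt * laplacian (\<mu> (Suc n)) x)
      has_integral integral (cbox l u) (\<phi> n) + dt * 0) (cbox l u)"
    by (intro has_integral_add) (auto simp: has_integral_integral)
  moreover have "\<phi> (Suc n) = (\<lambda>x. \<phi> n x + dt * laplacian (\<mu> (Suc n)) x)"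
    using dt by (simp add: fun_eq_iff scheme_phi[symmetric])
  ultimately have "(\<phi> (Suc n) has_integral integral (cbox l u) (\<phi> n) + dt * 0) (cbox l u)"
    by (simp only:)
  then show "integral (cbox l u) (\<phi> (Suc n)) = integral (cbox l u) (\<phi> n)"
    by (simp add: integral_unique)
qed

end
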